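(* Let $(A,\mu,\alpha,\beta)$ be a regular BiHom-algebra over a field $\mathbb{K}$ of characteristic $0$. If $(A,\mu,\alpha,\beta)$ is right BiHom-alternative and BiHom-flexible, then it is BiHom-alternative.
   Context: All vector spaces are over a field $\mathbb{K}$ of characteristic $0$. A BiHom-algebra is a quadruple $(A,\mu,\alpha,\beta)$ where $A$ is a vector space, $\mu:A\otimes A\to A$, $\alpha,\beta:A\to A$ are linear maps, and $\alpha\beta=\beta\alpha$. It is regular if $\alpha$ and $\beta$ are bijective. The BiHom-associator is the trilinear map $as_{\alpha,\beta}(x,y,z)=\mu(\mu(x,y),\beta(z))-\mu(\alpha(x),\mu(y,z))$. The BiHom-algebra is: - left BiHom-alternative if $as_{\alpha,\beta}(\beta(x),\alpha(y),z)+as_{\alpha,\beta}(\beta(y),\alpha(x),z)=0$ for all $x,y,z\in A$; - right BiHom-alternative if $as_{\alpha,\beta}(x,\beta(y),\alpha(z))+as_{\alpha,\beta}(x,\beta(z),\alpha(y))=0$ for all $x,y,z\in A$; - BiHom-alternative if it is both left and right BiHom-alternative; - BiHom-flexible if $as_{\alpha,\beta}(\beta^{2}(x),\alpha\beta(y),\alpha^{2}(z))+as_{\alpha,\beta}(\beta^{2}(z),\alpha\beta(y),\alpha^{2}(x))=0$ for all $x,y,z\in A$. *)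

theory Defs
  imports Complex_Main
begin

(* The underlying vector space A is the whole type 'a, over the field 'k of characteristic 0.
   A linear map A \<otimes> A \<rightarrow> A is given by the corresponding bilinear map A \<times> A \<rightarrow> A, written curried. *)
locale bihom_algebra = vector_space scale
  for scale :: "'k::field_char_0 \<Rightarrow> 'a::ab_group_add \<Rightarrow> 'a" +
  fixes \<mu> :: "'a \<Rightarrow> 'a \<Rightarrow> 'a"
    and \<alpha> \<beta> :: "'a \<Rightarrow> 'a"
  assumes mu_linear_left: "Vector_Spaces.linear scale scale (\<lambda>x. \<mu> x y)"
    and mu_linear_right: "Vector_Spaces.linear scale scale (\<lambda>y. \<mu> x y)"
    and alpha_linear: "Vector_Spaces.linear scale scale \<alpha>"
    and beta_linear: "Vector_Spaces.linear scale scale \<beta>"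
    and alpha_beta_commute: "\<alpha> \<circ> \<beta> = \<beta> \<circ> \<alpha>"

locale regular_bihom_algebra = bihom_algebra +
  assumes bij_alpha: "bij \<alpha>"
    and bij_beta: "bij \<beta>"

definition bihom_associator ::
    "('a::ab_group_add \<Rightarrow> 'a \<Rightarrow> 'a) \<Rightarrow> ('a \<Rightarrow> 'a) \<Rightarrow> ('a \<Rightarrow> 'a) \<Rightarrow> 'a \<Rightarrow> 'a \<Rightarrow> 'a \<Rightarrow> 'a"
  where "bihom_associator \<mu> \<alpha> \<beta> x y z = \<mu> (\<mu> x y) (\<beta> z) - \<mu> (\<alpha> x) (\<mu> y z)"

definition left_bihom_alternative ::
    "('a::ab_group_add \<Rightarrow> 'a \<Rightarrow> 'a) \<Rightarrow> ('a \<Rightarrow> 'a) \<Rightarrow> ('a \<Rightarrow> 'a) \<Rightarrow> bool"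
  where "left_bihom_alternative \<mu> \<alpha> \<beta> \<longleftrightarrow>
    (\<forall>x y z. bihom_associator \<mu> \<alpha> \<beta> (\<beta> x) (\<alpha> y) z
           + bihom_associator \<mu> \<alpha> \<beta> (\<beta> y) (\<alpha> x) z = 0)"

definition right_bihom_alternative ::
    "('a::ab_group_add \<Rightarrow> 'a \<Rightarrow> 'a) \<Rightarrow> ('a \<Rightarrow> 'a) \<Rightarrow> ('a \<Rightarrow> 'a) \<Rightarrow> bool"
  where "right_bihom_alternative \<mu> \<alpha> \<beta> \<longleftrightarrow>
    (\<forall>x y z. bihom_associator \<mu> \<alpha> \<beta> x (\<beta> y) (\<alpha> z)
           + bihom_associator \<mu> \<alpha> \<beta> x (\<beta> z) (\<alpha> y) = 0)"

definition bihom_alternative ::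
    "('a::ab_group_add \<Rightarrow> 'a \<Rightarrow> 'a) \<Rightarrow> ('a \<Rightarrow> 'a) \<Rightarrow> ('a \<Rightarrow> 'a) \<Rightarrow> bool"
  where "bihom_alternative \<mu> \<alpha> \<beta> \<longleftrightarrow>
    left_bihom_alternative \<mu> \<alpha> \<beta> \<and> right_bihom_alternative \<mu> \<alpha> \<beta>"

definition bihom_flexible ::
    "('a::ab_group_add \<Rightarrow> 'a \<Rightarrow> 'a) \<Rightarrow> ('a \<Rightarrow> 'a) \<Rightarrow> ('a \<Rightarrow> 'a) \<Rightarrow> bool"
  where "bihom_flexible \<mu> \<alpha> \<beta> \<longleftrightarrow>
    (\<forall>x y z. bihom_associator \<mu> \<alpha> \<beta> ((\<beta> ^^ 2) x) ((\<alpha> \<circ> \<beta>) y) ((\<alpha> ^^ 2) z)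
           + bihom_associator \<mu> \<alpha> \<beta> ((\<beta> ^^ 2) z) ((\<alpha> \<circ> \<beta>) y) ((\<alpha> ^^ 2) x) = 0)"

end

theory Submission
  imports Defs
begin

text \<open>
  Write \<open>T x y z\<close> for the BiHom-associator at \<open>\<beta>\<^sup>2 x\<close>, \<open>\<alpha>\<beta> y\<close>, \<open>\<alpha>\<^sup>2 z\<close>. Flexibility says that \<open>T\<close> is
  skew under the transposition of its outer arguments, and right alternativity, evaluated at
  \<open>\<beta>\<^sup>2 x\<close>, \<open>\<alpha> y\<close>, \<open>\<alpha> z\<close>, says that it is skew under the transposition of its last two. These two
  transpositions generate the symmetric group on the three arguments; in particular the transposition
  of the first two arguments is a conjugate of one by the other, so \<open>T\<close> is skew under it
  as well. Because \<open>\<alpha>\<close> and \<open>\<beta>\<close> are surjective, every triple of arguments in the left alternative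
  law is of the form \<open>\<beta> x\<close>, \<open>\<beta> y\<close>, \<open>\<alpha>\<^sup>2 z\<close>, where that law becomes this last skew symmetry.
\<close>

theorem proposition2p6:
  fixes scale :: "'k::field_char_0 \<Rightarrow> 'a::ab_group_add \<Rightarrow> 'a"
    and \<mu> :: "'a \<Rightarrow> 'a \<Rightarrow> 'a"
    and \<alpha> \<beta> :: "'a \<Rightarrow> 'a"
  assumes "regular_bihom_algebra scale \<mu> \<alpha> \<beta>"
    and "right_bihom_alternative \<mu> \<alpha> \<beta>"
    and "bihom_flexible \<mu> \<alpha> \<beta>"
  shows "bihom_alternative \<mu> \<alpha> \<beta>"
proof -
  interpret regular_bihom_algebra scale \<mu> \<alpha> \<beta> by fact
  have comm: "\<alpha> (\<beta> x) = \<beta> (\<alpha> x)" for x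
    using alpha_beta_commute by (metis comp_apply)
  define T where "T x y z = bihom_associator \<mu> \<alpha> \<beta> (\<beta> (\<beta> x)) (\<beta> (\<alpha> y)) (\<alpha> (\<alpha> z))" for x y z
  have skew_last: "T x y z = - T x z y" for x y z
    using assms(2) unfolding right_bihom_alternative_def T_def
    by (simp add: eq_neg_iff_add_eq_0)
  have skew_outer: "T x y z = - T z y x" for x y z
    using assms(3) unfolding bihom_flexible_def T_def
    by (simp add: eq_neg_iff_add_eq_0 numeral_2_eq_2 comm)
  have skew_first: "T x y z = - T y x z" for x y z
  proof -
    have "T x y z = - T z y x" by (rule skew_outer)
    also have "\<dots> = T z x y" by (simp add: skew_last[of z y x])
    also have "\<dots> = - T y x z" by (rule skew_outer)
    finally show ?thesis .
  qed
  have "left_bihom_alternative \<mu> \<alpha> \<beta>"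
    unfolding left_bihom_alternative_def
  proof (intro allI)
    fix x y z
    obtain x' y' where xy: "x = \<beta> x'" "y = \<beta> y'"
      using bij_beta by (meson bij_pointE)
    obtain z' where z: "z = \<alpha> (\<alpha> z')"
      using bij_alpha by (metis bij_pointE)
    have "T x' y' z' + T y' x' z' = 0"
      by (simp add: skew_first[of x' y' z'])
    then show "bihom_associator \<mu> \<alpha> \<beta> (\<beta> x) (\<alpha> y) z + bihom_associator \<mu> \<alpha> \<beta> (\<beta> y) (\<alpha> x) z = 0"
      by (simp add: T_def xy z comm)
  qed
  with assms(2) show ?thesis
    by (simp add: bihom_alternative_def)
qed

end
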